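(* Consider the stochastic MPC scheme described in the context, with i.i.d. zero-mean disturbances $w(k)$, $\mathbb{E}(w(k))=0$, $\mathrm{var}(w(k))=\Sigma^w$ for all $0\le k\le\bar N$, quadratic costs $l_k(x,u)=\|x\|_Q^2+\|u\|_R^2$ for all $k$ and $l_f(x)=\|x\|_P^2$ with $Q\succeq0$, $R\succ0$, and $P$ the solution of the Lyapunov equation $(A+BK)^\top P(A+BK)-P=-(Q+K^\top RK)$. Let $J^*(x,z)$ denote the optimal cost of problem $(\mathcal{P}_k)$ with initial measured state $x_0=x$ and nominal initial state $z_0=z$. Then, under the control law $u(k)=Ke_0(k)+v_0^*(k)$, $$\mathbb{E}\big(J^*(x(k+1),z(k+1))-J^*(x(k),z(k))\,\big|\,x(k),z(k)\big)\le-\|x(k)\|_Q^2-\|u(k)\|_R^2+\mathrm{tr}(P\Sigma^w).$$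
   Context: $\|x\|_P=\sqrt{x^\top Px}$. System: $x(k+1)=Ax(k)+Bu(k)+w(k)$, $x\in\mathbb{R}^{n_x}$, $u\in\mathbb{R}^{n_u}$, finite horizon $\bar N$. $\mathcal{X},\mathcal{U}$ convex sets; $\mathcal{A}\ominus\mathcal{B}=\{a\in\mathcal{A}: a+b\in\mathcal{A}\ \forall b\in\mathcal{B}\}$. A fixed stabilizing gain $K\in\mathbb{R}^{n_u\times n_x}$ is given; $\mathcal{R}^x_k,\mathcal{R}^u_k$ ($0\le k\le\bar N$) are given tightening sets; $\mathcal{R}_f$ is a set with $\mathcal{R}_f\supseteq\bigcup_k\mathcal{R}^x_k$, $K\mathcal{R}_f\supseteq\bigcup_k\mathcal{R}^u_k$, and the terminal set $\mathcal{Z}_f$ satisfies $\mathcal{Z}_f\subseteq\mathcal{X}\ominus\mathcal{R}_f$, $(A+BK)\mathcal{Z}_f\subseteq\mathcal{Z}_f$, $K\mathcal{Z}_f\subseteq\mathcal{U}\ominus K\mathcal{R}_f$. Problem $(\mathcal{P}_k)$ at time $k$: minimize over $v_0,\dots,v_{N-1}$ the cost $\mathbb{E}_{W_k}\big(l_f(x_N)+\sum_{i=0}^{N-1}l_{k+i}(x_i,u_i)\big)$ subject to $x_i=z_i+e_i$, $u_i=Ke_i+v_i$, $z_{i+1}=Az_i+Bv_i$, $e_{i+1}=(A+BK)e_i+w_i$, where $W_k=[w_0^\top,\dots,w_N^\top]^\top$ has the conditional distribution of $[w(k)^\top,\dots,w(k+N)^\top]^\top$ given the realized $w(0),\dots,w(k-1)$;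 constraints $z_i\in\mathcal{X}\ominus\mathcal{R}^x_{i+k}$, $v_i\in\mathcal{U}\ominus\mathcal{R}^u_{i+k}$ ($i=0,\dots,N-1$), $z_N\in\mathcal{Z}_f$; initialization $x_0=x(k)$, $z_0=z_1(k-1)$ (with $z_0(0)=x(0)$), $e_0=x_0-z_0$. Closed-loop nominal state $z(k)=z_0(k)$; applied input $u(k)=Ke_0(k)+v_0^*(k)$ with $v^*(k)$ optimal for $(\mathcal{P}_k)$. *)

theory Defs
  imports "HOL-Probability.Probability"
begin

text \<open>Squared weighted norm: qf M x = x' M x = (norm x wrt M)^2.\<close>
definition qf :: "real^'k^'k \<Rightarrow> real^'k \<Rightarrow> real" where
  "qf M x = x \<bullet> (M *v x)"

text \<open>Pontryagin difference, as in the paper.\<close>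
definition pdiff :: "('a::plus) set \<Rightarrow> 'a set \<Rightarrow> 'a set" where
  "pdiff S T = {a \<in> S. \<forall>b\<in>T. a + b \<in> S}"

text \<open>Nominal prediction z_{i+1} = A z_i + B v_i.\<close>
fun zpred :: "real^'n^'n \<Rightarrow> real^'m^'n \<Rightarrow> real^'n \<Rightarrow> (nat \<Rightarrow> real^'m) \<Rightarrow> nat \<Rightarrow> real^'n" where
  "zpred A B z0 v 0 = z0"
| "zpred A B z0 v (Suc i) = A *v zpred A B z0 v i + B *v v i"

text \<open>Error prediction e_{i+1} = (A+BK) e_i + w_i.\<close>
fun epred :: "real^'n^'n \<Rightarrow> real^'m^'n \<Rightarrow> real^'n^'m \<Rightarrow> real^'n \<Rightarrow> (nat \<Rightarrow> real^'n) \<Rightarrow> nat \<Rightarrow> real^'n" where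
  "epred A B K e0 w 0 = e0"
| "epred A B K e0 w (Suc i) = (A + B ** K) *v epred A B K e0 w i + w i"

text \<open>Realised cost for a disturbance realisation w = (w_0,...,w_N), with
  x_0 = x, z_0 = z, e_0 = x - z, x_i = z_i + e_i, u_i = K e_i + v_i.\<close>
definition sample_cost ::
  "real^'n^'n \<Rightarrow> real^'m^'n \<Rightarrow> real^'n^'m \<Rightarrow> real^'n^'n \<Rightarrow> real^'m^'m \<Rightarrow> real^'n^'n
   \<Rightarrow> nat \<Rightarrow> real^'n \<Rightarrow> real^'n \<Rightarrow> (nat \<Rightarrow> real^'m) \<Rightarrow> (nat \<Rightarrow> real^'n) \<Rightarrow> real" where
  "sample_cost A B K Q R P N x z v w =
     (let zs = zpred A B z v; es = epred A B K (x - z) w in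
      qf P (zs N + es N) + (\<Sum>i<N. qf Q (zs i + es i) + qf R (K *v es i + v i)))"

text \<open>Expected cost of problem (P_k): expectation over W = (w_0,...,w_N), i.i.d. with law D.\<close>
definition exp_cost ::
  "real^'n^'n \<Rightarrow> real^'m^'n \<Rightarrow> real^'n^'m \<Rightarrow> real^'n^'n \<Rightarrow> real^'m^'m \<Rightarrow> real^'n^'n
   \<Rightarrow> (real^'n) measure \<Rightarrow> nat \<Rightarrow> real^'n \<Rightarrow> real^'n \<Rightarrow> (nat \<Rightarrow> real^'m) \<Rightarrow> real" where
  "exp_cost A B K Q R P D N x z v =
     (\<integral>w. sample_cost A B K Q R P N x z v w \<partial>(PiM {..N} (\<lambda>_. D)))"

text \<open>Feasible decision sequences v_0..v_{N-1} of (P_k) with nominal initial state z.\<close>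
definition feasible ::
  "real^'n^'n \<Rightarrow> real^'m^'n \<Rightarrow> (real^'n) set \<Rightarrow> (real^'m) set \<Rightarrow> (nat \<Rightarrow> (real^'n) set)
   \<Rightarrow> (nat \<Rightarrow> (real^'m) set) \<Rightarrow> (real^'n) set \<Rightarrow> nat \<Rightarrow> nat \<Rightarrow> real^'n \<Rightarrow> (nat \<Rightarrow> real^'m) set" where
  "feasible A B X U Rx Ru Zf N k z =
     {v. (\<forall>i<N. zpred A B z v i \<in> pdiff X (Rx (i + k)) \<and> v i \<in> pdiff U (Ru (i + k)))
         \<and> zpred A B z v N \<in> Zf}"

text \<open>Optimal value J^*(x,z) of (P_k).\<close>
definition Jstar ::
  "real^'n^'n \<Rightarrow> real^'m^'n \<Rightarrow> real^'n^'m \<Rightarrow> real^'n^'n \<Rightarrow> real^'m^'m \<Rightarrow> real^'n^'n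
   \<Rightarrow> (real^'n) measure \<Rightarrow> (real^'n) set \<Rightarrow> (real^'m) set \<Rightarrow> (nat \<Rightarrow> (real^'n) set)
   \<Rightarrow> (nat \<Rightarrow> (real^'m) set) \<Rightarrow> (real^'n) set \<Rightarrow> nat \<Rightarrow> nat \<Rightarrow> real^'n \<Rightarrow> real^'n \<Rightarrow> real" where
  "Jstar A B K Q R P D X U Rx Ru Zf N k x z =
     Inf (exp_cost A B K Q R P D N x z ` feasible A B X U Rx Ru Zf N k z)"

end

theory Submission
  imports Defs
begin

text \<open>The expected cost of a decision sequence separates into the noise-free cost of the
  nominal prediction plus a constant \<open>C\<close> (the expected cost of the error dynamics started at
  \<open>0\<close>): the cross terms are linear in the zero-mean noise. Hence \<open>J\<^sup>*(x(k), z(k))\<close> is the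
  noise-free cost of \<open>v\<^sup>*(k)\<close> plus \<open>C\<close>. At time \<open>k + 1\<close> the shifted sequence (the tail of
  \<open>v\<^sup>*(k)\<close>, then \<open>K\<close> applied to the terminal nominal state) is feasible, because \<open>Z\<^sub>f\<close> is
  invariant and lies in the constraint sets tightened by \<open>R\<^sub>f\<close>; so \<open>J\<^sup>*(x(k + 1), z(k + 1))\<close>
  is at most its noise-free cost plus \<open>C\<close>. By the Lyapunov equation, that cost from
  \<open>A x + B u + w\<close> equals the old cost minus the stage cost \<open>l(x(k), u(k))\<close>, plus
  \<open>\<parallel>w\<parallel>\<^sub>P\<^sup>2\<close> and a term linear in \<open>w\<close>; taking expectations produces \<open>tr(P \<Sigma>)\<close>.\<close>

section \<open>Quadratic forms and the Lyapunov equation\<close>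

lemma qf_zero [simp]: "qf M 0 = 0"
  unfolding qf_def by simp

lemma qf_matrix_add: "qf (M + M') y = qf M y + qf M' y"
  unfolding qf_def by (simp add: matrix_vector_mult_add_rdistrib inner_add_right)

lemma qf_matrix_diff: "qf (M - M') y = qf M y - qf M' y"
  unfolding qf_def by (simp add: matrix_vector_mult_diff_rdistrib inner_diff_right)

lemma qf_matrix_uminus: "qf (- M) y = - qf M y"
  using qf_matrix_diff[of 0 M y] by (simp add: qf_def)

lemma qf_congruence: "qf (transpose L ** M ** L) y = qf M (L *v y)"
  unfolding qf_def matrix_vector_mul_assoc[symmetric] transpose_matrix_vector
  by (metis dot_lmul_matrix inner_commute)

lemma qf_add: "qf M (a + b) = qf M a + qf M b + (a v* M + M *v a) \<bullet> b"
  unfolding qf_def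
  by (simp add: matrix_vector_right_distrib inner_add_left inner_add_right dot_lmul_matrix
      inner_commute[of "M *v a" b])

lemma qf_lyapunov_step:
  assumes "transpose AK ** P ** AK - P = - (Q + transpose K ** R ** K)"
  shows "qf P (AK *v y) = qf P y - qf Q y - qf R (K *v y)"
  using arg_cong[OF assms, of "\<lambda>M. qf M y"]
  by (simp add: qf_matrix_add qf_matrix_diff qf_matrix_uminus qf_congruence)

lemma lyapunov_solution_nonneg:
  assumes lyap: "transpose AK ** P ** AK - P = - (Q + transpose K ** R ** K)"
    and stable: "(\<lambda>j. ((*v) AK ^^ j) y) \<longlonglongrightarrow> 0"
    and Q: "\<forall>y. 0 \<le> qf Q y" and R: "\<forall>y. 0 \<le> qf R y"
  shows "0 \<le> qf P y"
proof -
  have decreasing: "qf P (((*v) AK ^^ j) y) \<le> qf P y" for j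
  proof (induction j)
    case (Suc j)
    have "qf P (AK *v ((*v) AK ^^ j) y) \<le> qf P (((*v) AK ^^ j) y)"
      using qf_lyapunov_step[OF lyap, of "((*v) AK ^^ j) y"] Q[rule_format, of "((*v) AK ^^ j) y"]
        R[rule_format, of "K *v ((*v) AK ^^ j) y"]
      by linarith
    then show ?case using Suc by simp
  qed simp
  have "(\<lambda>j. qf P (((*v) AK ^^ j) y)) \<longlonglongrightarrow> qf P 0"
    unfolding qf_def
    by (intro tendsto_intros bounded_linear.tendsto[OF matrix_vector_mul_bounded_linear] stable)
  then have "qf P 0 \<le> qf P y"
    by (rule LIMSEQ_le_const2) (use decreasing in auto)
  then show ?thesis by simp
qed

lemma norm_matrix_vector_le: "norm ((M :: real^'n^'m) *v y) \<le> onorm ((*v) M) * norm y"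
  by (rule onorm[OF matrix_vector_mul_bounded_linear])

lemma continuous_on_matrix_vector_mult [continuous_intros]:
  "continuous_on S f \<Longrightarrow> continuous_on S (\<lambda>x. (M :: real^'n^'m) *v f x)"
  by (rule bounded_linear.continuous_on[OF matrix_vector_mul_bounded_linear])

lemma continuous_on_qf [continuous_intros]:
  "continuous_on S f \<Longrightarrow> continuous_on S (\<lambda>x. qf M (f x))"
  unfolding qf_def by (intro continuous_intros)

lemma borel_measurable_matrix_vector_mult [measurable (raw)]:
  "f \<in> borel_measurable \<mu> \<Longrightarrow> (\<lambda>\<omega>. (M :: real^'n^'m) *v f \<omega>) \<in> borel_measurable \<mu>"
  by (rule borel_measurable_continuous_on[of "(*v) M"])
    (simp_all add: linear_continuous_on matrix_vector_mul_bounded_linear)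

section \<open>Predicted trajectories and their costs\<close>

lemma zpred_zero [simp]: "zpred A B 0 (\<lambda>_. 0) i = 0"
  by (induction i) simp_all

lemma epred_add:
  "epred A B K (e + e') (\<lambda>j. w j + w' j) i = epred A B K e w i + epred A B K e' w' i"
  by (induction i) (simp_all add: matrix_vector_right_distrib algebra_simps)

lemma epred_Suc_no_noise:
  "epred A B K e (\<lambda>_. 0) (Suc i) = epred A B K ((A + B ** K) *v e) (\<lambda>_. 0) i"
  by (induction i) simp_all

lemma continuous_on_epred [continuous_intros]:
  "continuous_on S f \<Longrightarrow> continuous_on S (\<lambda>x. epred A B K (f x) w i)"
  by (induction i) (auto intro!: continuous_intros)

lemma continuous_on_sample_cost: "continuous_on S (\<lambda>x. sample_cost A B K Q R P N x z v w)"
  unfolding sample_cost_def Let_def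
  by (intro continuous_intros)

lemma sample_cost_nonneg:
  assumes "\<forall>y. 0 \<le> qf P y" and "\<forall>y. 0 \<le> qf Q y" and "\<forall>y. 0 \<le> qf R y"
  shows "0 \<le> sample_cost A B K Q R P N x z v w"
  unfolding sample_cost_def Let_def using assms by (intro add_nonneg_nonneg sum_nonneg) auto

lemma sample_cost_free_response:
  assumes lyap: "transpose (A + B ** K) ** P ** (A + B ** K) - P = - (Q + transpose K ** R ** K)"
  shows "sample_cost A B K Q R P N y 0 (\<lambda>_. 0) (\<lambda>_. 0) = qf P y"
proof -
  let ?e = "epred A B K y (\<lambda>_. 0)"
  have "qf P (?e N) + (\<Sum>i<N. qf Q (?e i) + qf R (K *v ?e i)) = qf P y"
  proof (induction N)
    case (Suc N)
    then show ?case using qf_lyapunov_step[OF lyap, of "?e N"] by simp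
  qed simp
  then show ?thesis unfolding sample_cost_def by simp
qed

lemma sample_cost_perturbed:
  obtains c where "\<And>y w. sample_cost A B K Q R P N (x + y) z v w =
      sample_cost A B K Q R P N x z v (\<lambda>_. 0) + sample_cost A B K Q R P N y 0 (\<lambda>_. 0) w
      + (\<Sum>i\<le>N. c i \<bullet> epred A B K y w i)"
proof -
  define xs where "xs i = zpred A B z v i + epred A B K (x - z) (\<lambda>_. 0) i" for i
  define us where "us i = K *v epred A B K (x - z) (\<lambda>_. 0) i + v i" for i
  (* c i is the gradient of the i-th stage cost (of the terminal cost for i = N) along the
     noise-free trajectory; it carries the cross terms, which are linear in the perturbation. *)
  define c where "c i = (if i < N then (xs i v* Q + Q *v xs i) + (us i v* R + R *v us i) v* K
                         else xs N v* P + P *v xs N)" for i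
  have "sample_cost A B K Q R P N (x + y) z v w =
      sample_cost A B K Q R P N x z v (\<lambda>_. 0) + sample_cost A B K Q R P N y 0 (\<lambda>_. 0) w
      + (\<Sum>i\<le>N. c i \<bullet> epred A B K y w i)" for y w
  proof -
    define n where "n = epred A B K y w"
    have e: "epred A B K (x + y - z) w i = epred A B K (x - z) (\<lambda>_. 0) i + n i" for i
      using epred_add[of A B K "x - z" y "\<lambda>_. 0" w i] by (simp add: n_def algebra_simps)
    have state: "zpred A B z v i + epred A B K (x + y - z) w i = xs i + n i" for i
      by (simp add: e xs_def)
    have input: "K *v epred A B K (x + y - z) w i + v i = us i + K *v n i" for i
      by (simp add: e us_def matrix_vector_right_distrib)
    have stage: "qf Q (xs i + n i) + qf R (us i + K *v n i)
        = (qf Q (xs i) + qf R (us i)) + (qf Q (n i) + qf R (K *v n i)) + c i \<bullet> n i"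
      if "i < N" for i
      using that by (simp add: qf_add c_def dot_lmul_matrix inner_add_left)
    have terminal: "qf P (xs N + n N) = qf P (xs N) + qf P (n N) + c N \<bullet> n N"
      by (simp add: qf_add c_def)
    have "sample_cost A B K Q R P N (x + y) z v w
        = qf P (xs N + n N) + (\<Sum>i<N. qf Q (xs i + n i) + qf R (us i + K *v n i))"
      unfolding sample_cost_def Let_def state input ..
    also have "\<dots> = (qf P (xs N) + (\<Sum>i<N. qf Q (xs i) + qf R (us i)))
        + (qf P (n N) + (\<Sum>i<N. qf Q (n i) + qf R (K *v n i))) + (\<Sum>i\<le>N. c i \<bullet> n i)"
      by (simp add: terminal stage sum.distrib lessThan_Suc_atMost[symmetric])
    also have "\<dots> = sample_cost A B K Q R P N x z v (\<lambda>_. 0) + sample_cost A B K Q R P N y 0 (\<lambda>_. 0) w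
        + (\<Sum>i\<le>N. c i \<bullet> epred A B K y w i)"
      by (simp add: sample_cost_def Let_def xs_def us_def n_def)
    finally show ?thesis .
  qed
  then show ?thesis using that by blast
qed

definition shifted_input ::
  "real^'n^'n \<Rightarrow> real^'m^'n \<Rightarrow> real^'n^'m \<Rightarrow> nat \<Rightarrow> real^'n \<Rightarrow> (nat \<Rightarrow> real^'m) \<Rightarrow> nat \<Rightarrow> real^'m" where
  "shifted_input A B K N z v i = (if Suc i < N then v (Suc i) else K *v zpred A B z v N)"

lemma zpred_shifted_input:
  "i < N \<Longrightarrow> zpred A B (A *v z + B *v v 0) (shifted_input A B K N z v) i = zpred A B z v (Suc i)"
  by (induction i) (simp_all add: shifted_input_def)

lemma zpred_shifted_input_horizon:
  assumes "0 < N"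
  shows "zpred A B (A *v z + B *v v 0) (shifted_input A B K N z v) N = (A + B ** K) *v zpred A B z v N"
proof -
  obtain M where N: "N = Suc M" using assms by (cases N) auto
  then show ?thesis
    using zpred_shifted_input[of M N A B z v K]
    by (simp add: shifted_input_def matrix_vector_mult_add_rdistrib matrix_vector_mul_assoc)
qed

lemma sample_cost_shifted_input:
  assumes lyap: "transpose (A + B ** K) ** P ** (A + B ** K) - P = - (Q + transpose K ** R ** K)"
    and "0 < N"
  shows "sample_cost A B K Q R P N (A *v x + B *v (K *v (x - z) + v 0)) (A *v z + B *v v 0)
           (shifted_input A B K N z v) (\<lambda>_. 0)
       = sample_cost A B K Q R P N x z v (\<lambda>_. 0) - qf Q x - qf R (K *v (x - z) + v 0)"
proof -
  obtain M where N: "N = Suc M" using \<open>0 < N\<close> by (cases N) auto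
  define x' where "x' = A *v x + B *v (K *v (x - z) + v 0)"
  define z' where "z' = A *v z + B *v v 0"
  define v' where "v' = shifted_input A B K N z v"
  define e where "e = epred A B K (x - z) (\<lambda>_. 0)"
  define e' where "e' = epred A B K (x' - z') (\<lambda>_. 0)"
  define stage where "stage i = qf Q (zpred A B z v i + e i) + qf R (K *v e i + v i)" for i
  have "x' - z' = (A + B ** K) *v (x - z)"
    unfolding x'_def z'_def by (simp add: algebra_simps matrix_vector_mul_assoc)
  then have e'_e: "e' i = e (Suc i)" for i
    unfolding e'_def e_def by (simp only: epred_Suc_no_noise)
  have state: "zpred A B z' v' i + e' i = zpred A B z v (Suc i) + e (Suc i)" if "i < N" for i
    unfolding z'_def v'_def e'_e using zpred_shifted_input[OF that] by simp
  have shifted_stage: "qf Q (zpred A B z' v' i + e' i) + qf R (K *v e' i + v' i) = stage (Suc i)"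
    if "i < M" for i
    using state[of i] that by (simp add: N e'_e v'_def shifted_input_def stage_def)
  define xN where "xN = zpred A B z v N + e N"
  have last_stage: "qf Q (zpred A B z' v' M + e' M) + qf R (K *v e' M + v' M) = qf Q xN + qf R (K *v xN)"
    using state[of M] by (simp add: N e'_e v'_def shifted_input_def xN_def matrix_vector_right_distrib add.commute)
  have terminal: "zpred A B z' v' N + e' N = (A + B ** K) *v xN"
    using zpred_shifted_input_horizon[OF \<open>0 < N\<close>, of A B z v K]
    by (simp add: z'_def v'_def e'_e e_def xN_def matrix_vector_right_distrib)
  have "sample_cost A B K Q R P N x' z' v' (\<lambda>_. 0)
      = qf P ((A + B ** K) *v xN) + (\<Sum>i<M. stage (Suc i)) + (qf Q xN + qf R (K *v xN))"
    unfolding sample_cost_def Let_def e'_def[symmetric] terminal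
    by (simp add: N shifted_stage last_stage)
  also have "\<dots> = qf P xN + (\<Sum>i<M. stage (Suc i))"
    using qf_lyapunov_step[OF lyap, of xN] by simp
  also have "\<dots> = sample_cost A B K Q R P N x z v (\<lambda>_. 0) - stage 0"
    unfolding sample_cost_def Let_def e_def[symmetric] stage_def[symmetric] xN_def N
      sum.lessThan_Suc_shift
    by simp
  finally show ?thesis
    by (simp add: x'_def z'_def v'_def stage_def e_def)
qed

lemma pdiff_antimono: "T \<subseteq> T' \<Longrightarrow> pdiff S T' \<subseteq> pdiff S T"
  unfolding pdiff_def by auto

lemma feasible_shifted_input:
  assumes Rf_x: "(\<Union>j\<in>{..Nbar}. Rx j) \<subseteq> Rf"
    and Rf_u: "(\<Union>j\<in>{..Nbar}. Ru j) \<subseteq> (*v) K ` Rf"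
    and Zf_X: "Zf \<subseteq> pdiff X Rf"
    and Zf_inv: "(*v) (A + B ** K) ` Zf \<subseteq> Zf"
    and Zf_U: "(*v) K ` Zf \<subseteq> pdiff U ((*v) K ` Rf)"
    and "0 < N" and horizon: "k + N \<le> Nbar"
    and feas: "v \<in> feasible A B X U Rx Ru Zf N k z"
  shows "shifted_input A B K N z v \<in> feasible A B X U Rx Ru Zf N (Suc k) (A *v z + B *v v 0)"
proof -
  define z' where "z' = A *v z + B *v v 0"
  define v' where "v' = shifted_input A B K N z v"
  have constr: "\<And>i. i < N \<Longrightarrow> zpred A B z v i \<in> pdiff X (Rx (i + k)) \<and> v i \<in> pdiff U (Ru (i + k))"
    and terminal: "zpred A B z v N \<in> Zf"
    using feas unfolding feasible_def by auto
  have "N + k \<in> {..Nbar}"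
    using horizon by simp
  then have "Rx (N + k) \<subseteq> Rf" "Ru (N + k) \<subseteq> (*v) K ` Rf"
    using Rf_x Rf_u by blast+
  then have last_constr: "zpred A B z v N \<in> pdiff X (Rx (N + k))" "K *v zpred A B z v N \<in> pdiff U (Ru (N + k))"
    using terminal Zf_X Zf_U pdiff_antimono by blast+
  have "zpred A B z' v' i \<in> pdiff X (Rx (i + Suc k)) \<and> v' i \<in> pdiff U (Ru (i + Suc k))"
    if "i < N" for i
  proof (cases "Suc i < N")
    case True
    then show ?thesis
      using constr[of "Suc i"] zpred_shifted_input[OF that, of A B z v K]
      by (simp add: z'_def v'_def shifted_input_def)
  next
    case False
    then have "Suc i = N"
      using that by simp
    moreover have "zpred A B z' v' i = zpred A B z v N" "v' i = K *v zpred A B z v N"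
      using zpred_shifted_input[OF that, of A B z v K] False \<open>Suc i = N\<close>
      by (simp_all add: z'_def v'_def shifted_input_def)
    ultimately show ?thesis
      using last_constr by (simp add: \<open>Suc i = N\<close>[symmetric])
  qed
  moreover have "zpred A B z' v' N \<in> Zf"
    using zpred_shifted_input_horizon[OF \<open>0 < N\<close>, of A B z v K] terminal Zf_inv
    by (auto simp: z'_def v'_def)
  ultimately show ?thesis
    unfolding feasible_def z'_def v'_def by blast
qed

section \<open>Expected costs under zero-mean noise\<close>

definition zero_mean_L2 :: "'a measure \<Rightarrow> ('a \<Rightarrow> real^'n) \<Rightarrow> bool" where
  "zero_mean_L2 \<mu> Y \<longleftrightarrow>
     integrable \<mu> Y \<and> integrable \<mu> (\<lambda>\<omega>. (norm (Y \<omega>))\<^sup>2) \<and> integral\<^sup>L \<mu> Y = 0"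

lemma zero_mean_L2_zero: "zero_mean_L2 \<mu> (\<lambda>_. 0)"
  unfolding zero_mean_L2_def by simp

lemma norm_add_power2_le: "(norm (a + b))\<^sup>2 \<le> 2 * (norm a)\<^sup>2 + 2 * (norm (b :: 'a::real_normed_vector))\<^sup>2"
proof -
  have "(norm (a + b))\<^sup>2 \<le> (norm a + norm b)\<^sup>2"
    by (simp add: norm_triangle_ineq power_mono)
  also have "\<dots> \<le> 2 * (norm a)\<^sup>2 + 2 * (norm b)\<^sup>2"
    using sum_squares_ge_zero[of "norm a - norm b" 0] by (simp add: power2_eq_square algebra_simps)
  finally show ?thesis .
qed

lemma zero_mean_L2_affine:
  assumes Y: "zero_mean_L2 \<mu> Y" and Z: "zero_mean_L2 \<mu> Z"
  shows "zero_mean_L2 \<mu> (\<lambda>\<omega>. M *v Y \<omega> + Z \<omega>)"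
proof -
  have int: "integrable \<mu> Y" "integrable \<mu> Z"
    and int2: "integrable \<mu> (\<lambda>\<omega>. (norm (Y \<omega>))\<^sup>2)" "integrable \<mu> (\<lambda>\<omega>. (norm (Z \<omega>))\<^sup>2)"
    and mean: "integral\<^sup>L \<mu> Y = 0" "integral\<^sup>L \<mu> Z = 0"
    using Y Z unfolding zero_mean_L2_def by auto
  have int_MY: "integrable \<mu> (\<lambda>\<omega>. M *v Y \<omega>)"
    by (rule integrable_bounded_linear[OF matrix_vector_mul_bounded_linear int(1)])
  have "integral\<^sup>L \<mu> (\<lambda>\<omega>. M *v Y \<omega>) = M *v integral\<^sup>L \<mu> Y"
    by (rule integral_bounded_linear[OF matrix_vector_mul_bounded_linear int(1)])
  then have "integral\<^sup>L \<mu> (\<lambda>\<omega>. M *v Y \<omega> + Z \<omega>) = 0"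
    using int_MY int mean by simp
  moreover have "integrable \<mu> (\<lambda>\<omega>. (norm (M *v Y \<omega> + Z \<omega>))\<^sup>2)"
  proof (rule Bochner_Integration.integrable_bound)
    show "integrable \<mu> (\<lambda>\<omega>. 2 * (onorm ((*v) M))\<^sup>2 * (norm (Y \<omega>))\<^sup>2 + 2 * (norm (Z \<omega>))\<^sup>2)"
      using int2 by auto
    have "(norm (M *v y + z))\<^sup>2 \<le> 2 * (onorm ((*v) M))\<^sup>2 * (norm y)\<^sup>2 + 2 * (norm z)\<^sup>2" for y z
    proof -
      have "(norm (M *v y))\<^sup>2 \<le> (onorm ((*v) M) * norm y)\<^sup>2"
        by (simp add: norm_matrix_vector_le power_mono)
      then show ?thesis
        using norm_add_power2_le[of "M *v y" z] by (simp add: power_mult_distrib)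
    qed
    then show "AE \<omega> in \<mu>. norm ((norm (M *v Y \<omega> + Z \<omega>))\<^sup>2)
        \<le> norm (2 * (onorm ((*v) M))\<^sup>2 * (norm (Y \<omega>))\<^sup>2 + 2 * (norm (Z \<omega>))\<^sup>2)"
      by (intro AE_I2) (simp add: abs_of_nonneg)
    show "(\<lambda>\<omega>. (norm (M *v Y \<omega> + Z \<omega>))\<^sup>2) \<in> borel_measurable \<mu>"
      using int by measurable
  qed
  ultimately show ?thesis
    unfolding zero_mean_L2_def using int_MY int by simp
qed

lemma zero_mean_L2_epred:
  assumes "zero_mean_L2 \<mu> e" and "\<And>j. j < i \<Longrightarrow> zero_mean_L2 \<mu> (\<lambda>\<omega>. w \<omega> j)"
  shows "zero_mean_L2 \<mu> (\<lambda>\<omega>. epred A B K (e \<omega>) (w \<omega>) i)"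
  using assms(2) by (induction i) (simp_all add: assms(1) zero_mean_L2_affine)

lemma integrable_qf:
  assumes "Y \<in> borel_measurable \<mu>" and "integrable \<mu> (\<lambda>\<omega>. (norm (Y \<omega>))\<^sup>2)"
  shows "integrable \<mu> (\<lambda>\<omega>. qf M (Y \<omega>))"
proof (rule Bochner_Integration.integrable_bound)
  show "integrable \<mu> (\<lambda>\<omega>. onorm ((*v) M) * (norm (Y \<omega>))\<^sup>2)"
    using assms(2) by simp
  show "(\<lambda>\<omega>. qf M (Y \<omega>)) \<in> borel_measurable \<mu>"
    using assms(1) unfolding qf_def by measurable
  have "\<bar>qf M y\<bar> \<le> onorm ((*v) M) * (norm y)\<^sup>2" for y
  proof -
    have "\<bar>qf M y\<bar> \<le> norm y * norm (M *v y)"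
      unfolding qf_def by (rule Cauchy_Schwarz_ineq2)
    also have "\<dots> \<le> norm y * (onorm ((*v) M) * norm y)"
      by (simp add: mult_left_mono norm_matrix_vector_le)
    finally show ?thesis by (simp add: power2_eq_square mult_ac)
  qed
  then show "AE \<omega> in \<mu>. norm (qf M (Y \<omega>)) \<le> norm (onorm ((*v) M) * (norm (Y \<omega>))\<^sup>2)"
    by (intro AE_I2) (simp add: abs_mult onorm_pos_le order.trans[OF _ abs_ge_self])
qed

lemma integral_inner_zero_mean:
  assumes "integrable \<mu> Y" and "integral\<^sup>L \<mu> Y = (0 :: real^'n)"
  shows "integrable \<mu> (\<lambda>\<omega>. c \<bullet> Y \<omega>)" and "integral\<^sup>L \<mu> (\<lambda>\<omega>. c \<bullet> Y \<omega>) = 0"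
  using integrable_bounded_linear[OF bounded_linear_inner_right assms(1)]
    integral_bounded_linear[OF bounded_linear_inner_right assms(1)] assms(2) by auto

lemma
  assumes "prob_space \<mu>"
    and noise: "\<And>i. i \<le> N \<Longrightarrow> zero_mean_L2 \<mu> (\<lambda>\<omega>. epred A B K (e \<omega>) (w \<omega>) i)"
  shows integrable_sample_cost_perturbed:
      "integrable \<mu> (\<lambda>\<omega>. sample_cost A B K Q R P N (x + e \<omega>) z v (w \<omega>))"
    and integral_sample_cost_perturbed:
      "(\<integral>\<omega>. sample_cost A B K Q R P N (x + e \<omega>) z v (w \<omega>) \<partial>\<mu>)
         = sample_cost A B K Q R P N x z v (\<lambda>_. 0)
           + (\<integral>\<omega>. sample_cost A B K Q R P N (e \<omega>) 0 (\<lambda>_. 0) (w \<omega>) \<partial>\<mu>)"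
proof -
  interpret prob_space \<mu> by fact
  obtain c where split: "\<And>y w. sample_cost A B K Q R P N (x + y) z v w =
      sample_cost A B K Q R P N x z v (\<lambda>_. 0) + sample_cost A B K Q R P N y 0 (\<lambda>_. 0) w
      + (\<Sum>i\<le>N. c i \<bullet> epred A B K y w i)"
    using sample_cost_perturbed by blast
  let ?n = "\<lambda>\<omega> i. epred A B K (e \<omega>) (w \<omega>) i"
  have n_int: "integrable \<mu> (\<lambda>\<omega>. ?n \<omega> i)"
    and n_int2: "integrable \<mu> (\<lambda>\<omega>. (norm (?n \<omega> i))\<^sup>2)"
    and n_mean: "(\<integral>\<omega>. ?n \<omega> i \<partial>\<mu>) = 0" if "i \<le> N" for i
    using noise[OF that] unfolding zero_mean_L2_def by auto
  have noise_cost: "integrable \<mu> (\<lambda>\<omega>. sample_cost A B K Q R P N (e \<omega>) 0 (\<lambda>_. 0) (w \<omega>))"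
  proof -
    have "integrable \<mu> (\<lambda>\<omega>. qf P (?n \<omega> N)
        + (\<Sum>i<N. qf Q (?n \<omega> i) + qf (transpose K ** R ** K) (?n \<omega> i)))"
      using n_int n_int2
      by (intro Bochner_Integration.integrable_add Bochner_Integration.integrable_sum integrable_qf
          borel_measurable_integrable) auto
    then show ?thesis
      unfolding sample_cost_def Let_def by (simp add: qf_congruence)
  qed
  have cross: "integrable \<mu> (\<lambda>\<omega>. \<Sum>i\<le>N. c i \<bullet> ?n \<omega> i)"
    "(\<integral>\<omega>. (\<Sum>i\<le>N. c i \<bullet> ?n \<omega> i) \<partial>\<mu>) = 0"
    using integral_inner_zero_mean[OF n_int n_mean]
    by (auto simp: Bochner_Integration.integral_sum)
  show "integrable \<mu> (\<lambda>\<omega>. sample_cost A B K Q R P N (x + e \<omega>) z v (w \<omega>))"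
    unfolding split using noise_cost cross by simp
  show "(\<integral>\<omega>. sample_cost A B K Q R P N (x + e \<omega>) z v (w \<omega>) \<partial>\<mu>)
      = sample_cost A B K Q R P N x z v (\<lambda>_. 0)
        + (\<integral>\<omega>. sample_cost A B K Q R P N (e \<omega>) 0 (\<lambda>_. 0) (w \<omega>) \<partial>\<mu>)"
    unfolding split using noise_cost cross by (simp add: prob_space)
qed

lemma zero_mean_L2_PiM_component:
  assumes "prob_space D" and D: "zero_mean_L2 D (\<lambda>w. w)" and "j \<in> I"
  shows "zero_mean_L2 (PiM I (\<lambda>_. D)) (\<lambda>W. W j)"
proof -
  have comp: "(\<lambda>W. W j) \<in> measurable (PiM I (\<lambda>_. D)) D"
    using measurable_component_singleton[OF \<open>j \<in> I\<close>, of "\<lambda>_. D"] by simp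
  have law: "distr (PiM I (\<lambda>_. D)) D (\<lambda>W. W j) = D"
    using distr_PiM_component[of I "\<lambda>_. D" j] assms by simp
  have meas: "(\<lambda>w. w) \<in> borel_measurable D"
    using D unfolding zero_mean_L2_def by (simp add: borel_measurable_integrable)
  show ?thesis
    using D integrable_distr_eq[OF comp, of "\<lambda>w. w"] integrable_distr_eq[OF comp, of "\<lambda>w. (norm w)\<^sup>2"]
      integral_distr[OF comp meas] meas
    unfolding zero_mean_L2_def law by simp
qed

lemma exp_cost_split:
  assumes "prob_space D" and "zero_mean_L2 D (\<lambda>w. w)"
  shows "exp_cost A B K Q R P D N x z v
       = sample_cost A B K Q R P N x z v (\<lambda>_. 0) + exp_cost A B K Q R P D N 0 0 (\<lambda>_. 0)"
proof -
  have "zero_mean_L2 (PiM {..N} (\<lambda>_. D)) (\<lambda>W. epred A B K 0 W i)" if "i \<le> N" for i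
    using that assms
    by (intro zero_mean_L2_epred zero_mean_L2_zero zero_mean_L2_PiM_component) auto
  then show ?thesis
    using integral_sample_cost_perturbed[of "PiM {..N} (\<lambda>_. D)" N A B K "\<lambda>_. 0" "\<lambda>W. W" Q R P x z v]
    unfolding exp_cost_def by (simp add: prob_space_PiM assms(1))
qed

lemma exp_cost_nonneg:
  assumes "\<forall>y. 0 \<le> qf P y" and "\<forall>y. 0 \<le> qf Q y" and "\<forall>y. 0 \<le> qf R y"
  shows "0 \<le> exp_cost A B K Q R P D N x z v"
  unfolding exp_cost_def by (intro integral_nonneg_AE AE_I2 sample_cost_nonneg[OF assms])

lemma integral_qf_eq_trace:
  fixes D :: "(real^'n) measure" and Sigma :: "real^'n^'n"
  assumes "(\<lambda>w. w) \<in> borel_measurable D" and "integrable D (\<lambda>w. (norm w)\<^sup>2)"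
    and cov: "\<forall>i j. Sigma $ i $ j = (\<integral>w. w $ i * w $ j \<partial>D)"
  shows "(\<integral>w. qf P w \<partial>D) = trace (P ** Sigma)"
proof -
  have [measurable]: "(\<lambda>w. w $ i) \<in> borel_measurable D" for i
    using measurable_compose[OF assms(1) borel_measurable_nth] by simp
  have "integrable D (\<lambda>w. w $ i * w $ j)" for i j
  proof (rule Bochner_Integration.integrable_bound[OF assms(2)])
    show "(\<lambda>w. w $ i * w $ j) \<in> borel_measurable D"
      by measurable
    have "\<bar>w $ i\<bar> * \<bar>w $ j\<bar> \<le> norm w * norm w" for w :: "real^'n"
      by (intro mult_mono component_le_norm_cart) auto
    then show "AE w in D. norm (w $ i * w $ j) \<le> norm ((norm w)\<^sup>2)"
      by (simp add: abs_mult power2_eq_square)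
  qed
  moreover have "qf P w = (\<Sum>i\<in>UNIV. \<Sum>j\<in>UNIV. P $ i $ j * (w $ i * w $ j))" for w
    unfolding qf_def inner_vec_def matrix_vector_mult_def
    by (simp add: sum_distrib_left mult_ac)
  ultimately have "(\<integral>w. qf P w \<partial>D) = (\<Sum>i\<in>UNIV. \<Sum>j\<in>UNIV. P $ i $ j * (\<integral>w. w $ i * w $ j \<partial>D))"
    by (simp add: Bochner_Integration.integral_sum Bochner_Integration.integrable_sum)
  also have "\<dots> = trace (P ** Sigma)"
    unfolding trace_def matrix_matrix_mult_def using cov by (simp add: mult_ac)
  finally show ?thesis .
qed

lemma
  fixes Sigma :: "real^'n^'n"
  assumes "prob_space D" and D: "zero_mean_L2 D (\<lambda>w. w)"
    and lyap: "transpose (A + B ** K) ** P ** (A + B ** K) - P = - (Q + transpose K ** R ** K)"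
    and cov: "\<forall>i j. Sigma $ i $ j = (\<integral>w. w $ i * w $ j \<partial>D)"
  shows integrable_sample_cost_initial_noise:
      "integrable D (\<lambda>w. sample_cost A B K Q R P N (y + w) z v (\<lambda>_. 0))"
    and integral_sample_cost_initial_noise:
      "(\<integral>w. sample_cost A B K Q R P N (y + w) z v (\<lambda>_. 0) \<partial>D)
         = sample_cost A B K Q R P N y z v (\<lambda>_. 0) + trace (P ** Sigma)"
proof -
  have noise: "zero_mean_L2 D (\<lambda>w. epred A B K w (\<lambda>_. 0) i)" for i
    by (intro zero_mean_L2_epred D zero_mean_L2_zero)
  show "integrable D (\<lambda>w. sample_cost A B K Q R P N (y + w) z v (\<lambda>_. 0))"
    by (rule integrable_sample_cost_perturbed[OF \<open>prob_space D\<close> noise])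
  have "(\<lambda>w. w) \<in> borel_measurable D" "integrable D (\<lambda>w. (norm w)\<^sup>2)"
    using D unfolding zero_mean_L2_def by (simp_all add: borel_measurable_integrable)
  then show "(\<integral>w. sample_cost A B K Q R P N (y + w) z v (\<lambda>_. 0) \<partial>D)
      = sample_cost A B K Q R P N y z v (\<lambda>_. 0) + trace (P ** Sigma)"
    using integral_sample_cost_perturbed[OF \<open>prob_space D\<close> noise, where x = y]
      integral_qf_eq_trace[OF _ _ cov] sample_cost_free_response[OF lyap]
    by simp
qed

section \<open>The optimal value function\<close>

lemma Jstar_le_exp_cost:
  assumes "\<forall>y. 0 \<le> qf P y" and "\<forall>y. 0 \<le> qf Q y" and "\<forall>y. 0 \<le> qf R y"
    and "v \<in> feasible A B X U Rx Ru Zf N k z"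
  shows "Jstar A B K Q R P D X U Rx Ru Zf N k x z \<le> exp_cost A B K Q R P D N x z v"
  unfolding Jstar_def
proof (rule cInf_lower)
  show "exp_cost A B K Q R P D N x z v \<in> exp_cost A B K Q R P D N x z ` feasible A B X U Rx Ru Zf N k z"
    using assms(4) by (rule imageI)
  show "bdd_below (exp_cost A B K Q R P D N x z ` feasible A B X U Rx Ru Zf N k z)"
    using exp_cost_nonneg[OF assms(1-3)] by (intro bdd_belowI2[where m = 0])
qed

lemma exp_cost_noise_le_Jstar:
  assumes "prob_space D" and "zero_mean_L2 D (\<lambda>w. w)"
    and "\<forall>y. 0 \<le> qf P y" and "\<forall>y. 0 \<le> qf Q y" and "\<forall>y. 0 \<le> qf R y"
    and "feasible A B X U Rx Ru Zf N k z \<noteq> {}"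
  shows "exp_cost A B K Q R P D N 0 0 (\<lambda>_. 0) \<le> Jstar A B K Q R P D X U Rx Ru Zf N k x z"
  unfolding Jstar_def
proof (rule cInf_greatest)
  show "exp_cost A B K Q R P D N x z ` feasible A B X U Rx Ru Zf N k z \<noteq> {}"
    using assms(6) by simp
  fix c
  assume "c \<in> exp_cost A B K Q R P D N x z ` feasible A B X U Rx Ru Zf N k z"
  then obtain v where "c = exp_cost A B K Q R P D N x z v"
    by blast
  then show "exp_cost A B K Q R P D N 0 0 (\<lambda>_. 0) \<le> c"
    using exp_cost_split[OF assms(1,2), of A B K Q R P N x z v] sample_cost_nonneg[OF assms(3-5)]
    by simp
qed

lemma borel_measurable_Inf_continuous:
  fixes f :: "'a::topological_space \<Rightarrow> 'b \<Rightarrow> real"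
  assumes "F \<noteq> {}" and cont: "\<And>v. v \<in> F \<Longrightarrow> continuous_on UNIV (\<lambda>x. f x v)"
    and "\<And>x. bdd_below (f x ` F)"
  shows "(\<lambda>x. Inf (f x ` F)) \<in> borel_measurable borel"
  unfolding borel_measurable_iff_less
proof
  fix a
  have "{x \<in> space borel. Inf (f x ` F) < a} = (\<Union>v\<in>F. (\<lambda>x. f x v) -` {..<a})"
    using assms by (auto simp: cInf_less_iff)
  moreover have "open ((\<lambda>x. f x v) -` {..<a})" if "v \<in> F" for v
    using continuous_on_open_vimage[of UNIV "\<lambda>x. f x v"] cont[OF that] by auto
  then have "open (\<Union>v\<in>F. (\<lambda>x. f x v) -` {..<a})"
    by (intro open_UN) auto
  ultimately show "{x \<in> space borel. Inf (f x ` F) < a} \<in> sets borel"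
    by (simp add: borel_open)
qed

lemma Jstar_borel_measurable:
  assumes "prob_space D" and "zero_mean_L2 D (\<lambda>w. w)"
    and "\<forall>y. 0 \<le> qf P y" and "\<forall>y. 0 \<le> qf Q y" and "\<forall>y. 0 \<le> qf R y"
    and "feasible A B X U Rx Ru Zf N k z \<noteq> {}"
  shows "(\<lambda>x. Jstar A B K Q R P D X U Rx Ru Zf N k x z) \<in> borel_measurable borel"
  unfolding Jstar_def
proof (rule borel_measurable_Inf_continuous)
  show "continuous_on UNIV (\<lambda>x. exp_cost A B K Q R P D N x z v)" for v
    unfolding exp_cost_split[OF assms(1,2), of A B K Q R P N _ z v]
    by (intro continuous_intros continuous_on_sample_cost)
  show "bdd_below ((\<lambda>v. exp_cost A B K Q R P D N x z v) ` feasible A B X U Rx Ru Zf N k z)" for x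
    using exp_cost_nonneg[OF assms(3-5)] by (intro bdd_belowI2[where m = 0]) auto
qed (fact assms(6))

lemma integral_mono_bounded_below:
  fixes g h :: "'a \<Rightarrow> real"
  assumes "finite_measure M" and "g \<in> borel_measurable M" and "integrable M h"
    and "\<And>x. x \<in> space M \<Longrightarrow> c \<le> g x" and "\<And>x. x \<in> space M \<Longrightarrow> g x \<le> h x"
  shows "integrable M g" and "integral\<^sup>L M g \<le> integral\<^sup>L M h"
proof -
  interpret finite_measure M by fact
  show int_g: "integrable M g"
  proof (rule Bochner_Integration.integrable_bound)
    show "integrable M (\<lambda>x. \<bar>h x\<bar> + \<bar>c\<bar>)"
      using assms(3) by simp
    have "\<bar>g x\<bar> \<le> \<bar>h x\<bar> + \<bar>c\<bar>" if "x \<in> space M" for x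
      using assms(4,5)[OF that] by linarith
    then show "AE x in M. norm (g x) \<le> norm (\<bar>h x\<bar> + \<bar>c\<bar>)"
      by (intro AE_I2) simp
  qed fact
  show "integral\<^sup>L M g \<le> integral\<^sup>L M h"
    using int_g assms(3,5) by (rule integral_mono)
qed

lemma
  fixes D :: "(real^'n) measure" and Sigma :: "real^'n^'n"
  assumes "prob_space D" and D_sets: "sets D = sets borel" and D: "zero_mean_L2 D (\<lambda>w. w)"
    and lyap: "transpose (A + B ** K) ** P ** (A + B ** K) - P = - (Q + transpose K ** R ** K)"
    and cov: "\<forall>i j. Sigma $ i $ j = (\<integral>w. w $ i * w $ j \<partial>D)"
    and psd: "\<forall>y. 0 \<le> qf P y" "\<forall>y. 0 \<le> qf Q y" "\<forall>y. 0 \<le> qf R y"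
    and feas: "v \<in> feasible A B X U Rx Ru Zf N k z"
  shows integrable_Jstar_initial_noise:
      "integrable D (\<lambda>w. Jstar A B K Q R P D X U Rx Ru Zf N k (y + w) z)"
    and integral_Jstar_initial_noise_le:
      "(\<integral>w. Jstar A B K Q R P D X U Rx Ru Zf N k (y + w) z \<partial>D)
         \<le> sample_cost A B K Q R P N y z v (\<lambda>_. 0) + exp_cost A B K Q R P D N 0 0 (\<lambda>_. 0)
           + trace (P ** Sigma)"
proof -
  interpret prob_space D by fact
  let ?J = "\<lambda>x. Jstar A B K Q R P D X U Rx Ru Zf N k x z"
  let ?C = "exp_cost A B K Q R P D N 0 0 (\<lambda>_. 0)"
  let ?s = "\<lambda>x. sample_cost A B K Q R P N x z v (\<lambda>_. 0)"
  have "?J \<in> borel_measurable borel"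
    using feas by (intro Jstar_borel_measurable[OF \<open>prob_space D\<close> D psd]) auto
  then have "(\<lambda>w. ?J (y + w)) \<in> borel_measurable borel"
    using measurable_compose[of "\<lambda>w. y + w" borel borel ?J] by simp
  then have meas: "(\<lambda>w. ?J (y + w)) \<in> borel_measurable D"
    by (simp add: measurable_cong_sets[OF D_sets refl])
  have lower: "?C \<le> ?J x" for x
    by (rule exp_cost_noise_le_Jstar[OF \<open>prob_space D\<close> D psd]) (use feas in auto)
  have upper: "?J x \<le> ?s x + ?C" for x
  proof -
    have "?J x \<le> exp_cost A B K Q R P D N x z v"
      by (rule Jstar_le_exp_cost[OF psd feas])
    then show ?thesis
      by (simp only: exp_cost_split[OF \<open>prob_space D\<close> D, of A B K Q R P N x z v])
  qed
  have int_s: "integrable D (\<lambda>w. ?s (y + w) + ?C)"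
    using integrable_sample_cost_initial_noise[OF \<open>prob_space D\<close> D lyap cov] by simp
  note mono = integral_mono_bounded_below[OF finite_measure_axioms meas int_s, of ?C]
  show "integrable D (\<lambda>w. ?J (y + w))"
    using mono(1) lower upper by blast
  have "(\<integral>w. ?J (y + w) \<partial>D) \<le> (\<integral>w. ?s (y + w) + ?C \<partial>D)"
    using mono(2) lower upper by blast
  also have "\<dots> = ?s y + ?C + trace (P ** Sigma)"
    using integrable_sample_cost_initial_noise[OF \<open>prob_space D\<close> D lyap cov]
      integral_sample_cost_initial_noise[OF \<open>prob_space D\<close> D lyap cov]
    by (simp add: prob_space)
  finally show "(\<integral>w. ?J (y + w) \<partial>D) \<le> ?s y + ?C + trace (P ** Sigma)" .
qed

theorem theorem3:
  fixes A :: "real^'n^'n" and B :: "real^'m^'n" and K :: "real^'n^'m"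
    and Q :: "real^'n^'n" and R :: "real^'m^'m" and P :: "real^'n^'n"
    and Sigma :: "real^'n^'n" and D :: "(real^'n) measure"
    and X :: "(real^'n) set" and U :: "(real^'m) set"
    and Rx :: "nat \<Rightarrow> (real^'n) set" and Ru :: "nat \<Rightarrow> (real^'m) set"
    and Rf :: "(real^'n) set" and Zf :: "(real^'n) set"
    and N Nbar k :: nat and x z :: "real^'n" and vs :: "nat \<Rightarrow> real^'m"
  assumes convX: "convex X" and convU: "convex U"
    and stab: "\<forall>y. (\<lambda>j. (((*v) (A + B ** K)) ^^ j) y) \<longlonglongrightarrow> 0"
    and Qsym: "transpose Q = Q" and Qpsd: "\<forall>y. 0 \<le> qf Q y"
    and Rsym: "transpose R = R" and Rpd: "\<forall>y. y \<noteq> 0 \<longrightarrow> 0 < qf R y"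
    and lyap: "transpose (A + B ** K) ** P ** (A + B ** K) - P = - (Q + transpose K ** R ** K)"
    and Rf_x: "(\<Union>j\<in>{..Nbar}. Rx j) \<subseteq> Rf"
    and Rf_u: "(\<Union>j\<in>{..Nbar}. Ru j) \<subseteq> (*v) K ` Rf"
    and Zf_X: "Zf \<subseteq> pdiff X Rf"
    and Zf_inv: "(*v) (A + B ** K) ` Zf \<subseteq> Zf"
    and Zf_U: "(*v) K ` Zf \<subseteq> pdiff U ((*v) K ` Rf)"
    and D_prob: "prob_space D" and D_sets: "sets D = sets borel"
    and D_int1: "integrable D (\<lambda>w. w)" and D_int2: "integrable D (\<lambda>w. (norm w)\<^sup>2)"
    and D_mean: "(\<integral>w. w \<partial>D) = 0"
    and D_var: "\<forall>i j. Sigma $ i $ j = (\<integral>w. w $ i * w $ j \<partial>D)"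
    and N_pos: "0 < N" and horizon: "k + N \<le> Nbar"
    and vs_feas: "vs \<in> feasible A B X U Rx Ru Zf N k z"
    and vs_opt: "\<forall>v \<in> feasible A B X U Rx Ru Zf N k z.
                   exp_cost A B K Q R P D N x z vs \<le> exp_cost A B K Q R P D N x z v"
  shows "(let u = K *v (x - z) + vs 0; z' = A *v z + B *v vs 0 in
          (\<integral>w. Jstar A B K Q R P D X U Rx Ru Zf N (Suc k) (A *v x + B *v u + w) z'
                - Jstar A B K Q R P D X U Rx Ru Zf N k x z \<partial>D)
          \<le> - qf Q x - qf R u + trace (P ** Sigma))"
proof -
  interpret D: prob_space D by (fact D_prob)
  have D: "zero_mean_L2 D (\<lambda>w. w)"
    using D_int1 D_int2 D_mean unfolding zero_mean_L2_def by simp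
  have Rpsd: "\<forall>y. 0 \<le> qf R y"
    using Rpd by (metis order.refl less_imp_le qf_zero)
  have Ppsd: "\<forall>y. 0 \<le> qf P y"
    using lyapunov_solution_nonneg[OF lyap] stab Qpsd Rpsd by blast
  define u where "u = K *v (x - z) + vs 0"
  define z' where "z' = A *v z + B *v vs 0"
  have J_now: "Jstar A B K Q R P D X U Rx Ru Zf N k x z = exp_cost A B K Q R P D N x z vs"
    unfolding Jstar_def using vs_feas vs_opt by (intro cInf_eq_minimum) auto
  have "shifted_input A B K N z vs \<in> feasible A B X U Rx Ru Zf N (Suc k) z'"
    unfolding z'_def by (rule feasible_shifted_input[OF Rf_x Rf_u Zf_X Zf_inv Zf_U N_pos horizon vs_feas])
  note J_next = integrable_Jstar_initial_noise[OF D_prob D_sets D lyap D_var Ppsd Qpsd Rpsd this]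
    integral_Jstar_initial_noise_le[OF D_prob D_sets D lyap D_var Ppsd Qpsd Rpsd this]
  have "sample_cost A B K Q R P N (A *v x + B *v u) z' (shifted_input A B K N z vs) (\<lambda>_. 0)
      = sample_cost A B K Q R P N x z vs (\<lambda>_. 0) - qf Q x - qf R u"
    unfolding u_def z'_def by (rule sample_cost_shifted_input[OF lyap N_pos])
  then show ?thesis
    using J_next[where y = "A *v x + B *v u"] J_now exp_cost_split[OF D_prob D, of A B K Q R P N x z vs]
    unfolding Let_def u_def[symmetric] z'_def[symmetric]
    by (simp add: D.prob_space Bochner_Integration.integral_diff)
qed

end
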